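(* For any positive integer $k$, the number of EVEN colored compositions of $k$ is equal to the number of ternary strings $s_1s_2\cdots s_k\in\{0,1,2\}^k$ of length $k$ such that no $0$ is immediately followed by a $1$, no $1$ is immediately followed by a $2$, $s_1\neq 2$, and $s_k\neq 0$.
   Context: A composition of a positive integer $k$ is a finite ordered sequence of positive integers (called parts) whose sum is $k$; positions of parts are numbered $1,2,3,\dots$ from left to right. An EVEN colored composition of $k$ is a composition of $k$ in which each part in an even position (2nd, 4th, ...) of size $p$ is given one of $p$ colors $1,\dots,p$, while the parts in odd positions are not colored. *)

theory Defs
  imports Main
begin

definition composition :: "nat \<Rightarrow> nat list \<Rightarrow> bool" where
  "composition k ps \<longleftrightarrow> (\<forall>p \<in> set ps. 0 < p) \<and> sum_list ps = k"

(* A coloured composition is a list of parts, each paired with its colour (None: not coloured).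
   List indices start at 0, whereas positions start at 1: index i is position i + 1. *)
definition even_colored_composition :: "nat \<Rightarrow> (nat \<times> nat option) list \<Rightarrow> bool" where
  "even_colored_composition k cs \<longleftrightarrow>
     composition k (map fst cs) \<and>
     (\<forall>i < length cs.
        if even (i + 1) then (\<exists>c \<in> {1..fst (cs ! i)}. snd (cs ! i) = Some c)
        else snd (cs ! i) = None)"

definition even_colored_compositions :: "nat \<Rightarrow> (nat \<times> nat option) list set" where
  "even_colored_compositions k = {cs. even_colored_composition k cs}"

definition ternary_strings :: "nat \<Rightarrow> nat list set" where
  "ternary_strings k = {s. length s = k \<and> set s \<subseteq> {0, 1, 2}}"

lemma finite_ternary_strings: "finite (ternary_strings k)"
  using finite_lists_length_eq[of "{0, 1, 2 :: nat}" k]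
  by (simp add: ternary_strings_def conj_commute)

lemma finite_even_colored_compositions: "finite (even_colored_compositions k)"
proof (rule finite_subset)
  let ?A = "{..k} \<times> insert None (Some ` {..k})"
  show "finite {cs. set cs \<subseteq> ?A \<and> length cs \<le> k}"
    by (rule finite_lists_length_le) simp
  show "even_colored_compositions k \<subseteq> {cs. set cs \<subseteq> ?A \<and> length cs \<le> k}"
  proof
    fix cs assume "cs \<in> even_colored_compositions k"
    then have pos: "\<forall>p \<in> set (map fst cs). 0 < p" and sum: "sum_list (map fst cs) = k"
      and col: "\<And>i. i < length cs \<Longrightarrow>
        if even (i + 1) then (\<exists>c \<in> {1..fst (cs ! i)}. snd (cs ! i) = Some c)
        else snd (cs ! i) = None"
      unfolding even_colored_compositions_def even_colored_composition_def composition_def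
      by blast+
    have len: "length ps \<le> sum_list ps" if "\<forall>p \<in> set ps. 0 < p" for ps :: "nat list"
      using that by (induction ps) auto
    have "length cs \<le> k"
      using len[OF pos] sum by simp
    moreover have "x \<in> ?A" if x: "x \<in> set cs" for x
    proof -
      obtain i where i: "i < length cs" "cs ! i = x"
        using x by (auto simp: in_set_conv_nth)
      have "fst x \<le> k"
        using member_le_sum_list[of "fst x" "map fst cs"] x sum by auto
      then show ?thesis
        using col[OF i(1)] i(2) by (cases x) (auto split: if_splits)
    qed
    ultimately show "cs \<in> {cs. set cs \<subseteq> ?A \<and> length cs \<le> k}"
      by blast
  qed
qed

end

(* Both families obey a linear recurrence on three quantities. For colored compositions these are
   the number O of compositions of n whose parts are colored in even positions, the number E of those
   colored in odd positions, and the partial sums T of O: removing the first part gives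
   O(n+1) = O(n) + E(n), E(n+1) = E(n) + T(n) and T(n+1) = T(n) + O(n+1) for n > 0.
   For strings of length n, let f0, f1, f2 count the admissible ones starting with 0, 1, 2 (here
   starting with 2 is permitted). Then O = f0 + f1, E = f0 + f2 and T = f0 + f1 + f2
   by induction on n. *)
theory Submission
  imports Defs
begin

text \<open>The flag tells whether the first part is colored. Removing the first part negates it, so
  the structure is closed under the recursion, which fixed position parities are not.\<close>

fun alternating :: "bool \<Rightarrow> (nat \<times> nat option) list \<Rightarrow> bool" where
  "alternating b [] \<longleftrightarrow> True"
| "alternating b ((p, c) # cs) \<longleftrightarrow>
     0 < p \<and> (if b then c \<in> Some ` {1..p} else c = None) \<and> alternating (\<not> b) cs"

definition alternating_compositions :: "bool \<Rightarrow> nat \<Rightarrow> (nat \<times> nat option) list set" where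
  "alternating_compositions b n = {cs. alternating b cs \<and> sum_list (map fst cs) = n}"

lemma alternating_iff_nth:
  "alternating b cs \<longleftrightarrow> (\<forall>p \<in> set (map fst cs). 0 < p) \<and>
     (\<forall>i < length cs. if even i = b then \<exists>c \<in> {1..fst (cs ! i)}. snd (cs ! i) = Some c
        else snd (cs ! i) = None)"
proof (induction b cs rule: alternating.induct)
  case (2 b p c cs)
  \<comment> \<open>Dropping the head shifts every index by one; negating the flag absorbs this
    change of parity.\<close>
  have "(even (Suc i) = b) = (even i = (\<not> b))" for i :: nat
    by auto
  then show ?case
    unfolding alternating.simps "2.IH" by (auto simp: All_less_Suc2)
qed simp

lemma even_colored_compositions_eq:
  "even_colored_compositions k = alternating_compositions False k"
  by (auto simp: even_colored_compositions_def even_colored_composition_def composition_def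
      alternating_compositions_def alternating_iff_nth)

lemma alternating_compositions_0: "alternating_compositions b 0 = {[]}"
proof -
  have "alternating b cs \<and> sum_list (map fst cs) = 0 \<longleftrightarrow> cs = []" for cs
    by (cases "(b, cs)" rule: alternating.cases) auto
  then show ?thesis
    by (simp add: alternating_compositions_def)
qed

text \<open>The index \<open>j\<close> is the sum of what follows the first part. The bound
  \<open>j \<le> n\<close> is exactly positivity of the first part \<open>Suc n - j\<close>.\<close>

lemma alternating_compositions_Suc_False:
  "alternating_compositions False (Suc n) =
     (\<lambda>(j, cs). (Suc n - j, None) # cs) ` (SIGMA j:{..n}. alternating_compositions True j)"
    (is "?L = ?f ` ?S")
proof
  show "?L \<subseteq> ?f ` ?S"
  proof
    fix cs assume "cs \<in> ?L"
    then obtain p ds where "cs = (p, None) # ds" "0 < p" "alternating True ds"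
      "p + sum_list (map fst ds) = Suc n"
      unfolding alternating_compositions_def
      by (cases "(False, cs)" rule: alternating.cases) auto
    then have "cs = ?f (sum_list (map fst ds), ds)" "(sum_list (map fst ds), ds) \<in> ?S"
      by (auto simp: alternating_compositions_def)
    then show "cs \<in> ?f ` ?S"
      by blast
  qed
qed (auto simp: alternating_compositions_def)

lemma alternating_compositions_Suc_True:
  "alternating_compositions True (Suc n) =
     (\<lambda>(j, c, cs). (Suc n - j, Some c) # cs) `
       (SIGMA j:{..n}. {1..Suc n - j} \<times> alternating_compositions False j)"
    (is "?L = ?f ` ?S")
proof
  show "?L \<subseteq> ?f ` ?S"
  proof
    fix cs assume "cs \<in> ?L"
    then obtain p c ds where "cs = (p, Some c) # ds" "0 < p" "c \<in> {1..p}" "alternating False ds"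
      "p + sum_list (map fst ds) = Suc n"
      unfolding alternating_compositions_def
      by (cases "(True, cs)" rule: alternating.cases) auto
    then have "cs = ?f (sum_list (map fst ds), c, ds)" "(sum_list (map fst ds), c, ds) \<in> ?S"
      by (auto simp: alternating_compositions_def)
    then show "cs \<in> ?f ` ?S"
      by blast
  qed
qed (auto simp: alternating_compositions_def)

lemma finite_alternating_compositions: "finite (alternating_compositions b n)"
proof (induction n arbitrary: b rule: less_induct)
  case (less n)
  show ?case
  proof (cases n)
    case 0
    then show ?thesis by (simp add: alternating_compositions_0)
  next
    case (Suc m)
    then have "finite (alternating_compositions b' j)" if "j \<le> m" for b' j
      using less that by simp
    then show ?thesis
      unfolding Suc
      by (cases b) (auto simp: alternating_compositions_Suc_False alternating_compositions_Suc_True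
          intro!: finite_imageI finite_SigmaI)
  qed
qed

lemma card_alternating_compositions_False:
  "card (alternating_compositions False (Suc n)) =
     (\<Sum>j\<le>n. card (alternating_compositions True j))"
proof -
  \<comment> \<open>For \<open>j \<le> n\<close> the subtraction loses nothing, so the first part
    determines \<open>j\<close>.\<close>
  have "inj_on (\<lambda>(j, cs). (Suc n - j, None :: nat option) # cs)
      (SIGMA j:{..n}. alternating_compositions True j)"
    by (auto simp: inj_on_def)
  then show ?thesis
    unfolding alternating_compositions_Suc_False
    by (simp add: card_image card_SigmaI finite_alternating_compositions)
qed

lemma card_alternating_compositions_True:
  "card (alternating_compositions True (Suc n)) =
     (\<Sum>j\<le>n. (Suc n - j) * card (alternating_compositions False j))"
proof -
  have "inj_on (\<lambda>(j, c, cs). (Suc n - j, Some c) # cs)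
      (SIGMA j:{..n}. {1..Suc n - j} \<times> alternating_compositions False j)"
    by (auto simp: inj_on_def)
  then show ?thesis
    unfolding alternating_compositions_Suc_True
    by (simp add: card_image card_SigmaI finite_alternating_compositions card_cartesian_product)
qed

text \<open>Passing from \<open>Suc n\<close> to \<open>Suc (Suc n)\<close> raises each weight
  \<open>Suc n - j\<close> with \<open>j \<le> n\<close> by one, and the new index
  \<open>j = Suc n\<close> enters with weight 1. The recurrence starts at \<open>Suc n\<close>
  because the empty composition makes it fail from 0 to 1.\<close>

lemma card_alternating_compositions_True_Suc_Suc:
  "card (alternating_compositions True (Suc (Suc n))) =
     card (alternating_compositions True (Suc n)) +
     (\<Sum>j\<le>Suc n. card (alternating_compositions False j))"
proof -
  have "(\<Sum>j\<le>n. (Suc (Suc n) - j) * f j) = (\<Sum>j\<le>n. (Suc n - j) * f j) + (\<Sum>j\<le>n. f j)"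
    for f :: "nat \<Rightarrow> nat"
    unfolding sum.distrib[symmetric] by (intro sum.cong) (auto simp: Suc_diff_le)
  then show ?thesis
    unfolding card_alternating_compositions_True by simp
qed

definition admissible :: "nat \<Rightarrow> nat \<Rightarrow> bool" where
  "admissible x y \<longleftrightarrow> \<not> (x = 0 \<and> y = 1) \<and> \<not> (x = 1 \<and> y = 2)"

text \<open>The letter \<open>x\<close> is the one just before \<open>s\<close>. Taking
  \<open>last (x # s)\<close> puts the end condition on \<open>x\<close> itself when
  \<open>s\<close> is empty. For \<open>x\<close> in \<open>{0, 1, 2}\<close> the cardinality is the
  count of admissible strings of length \<open>n + 1\<close> that start with
  \<open>x\<close>.\<close>

definition continuations :: "nat \<Rightarrow> nat \<Rightarrow> nat list set" where
  "continuations x n =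
     {s \<in> ternary_strings n. successively admissible (x # s) \<and> last (x # s) \<noteq> 0}"

lemma continuations_0: "continuations x 0 = (if x = 0 then {} else {[]})"
  by (auto simp: continuations_def ternary_strings_def)

lemma finite_continuations: "finite (continuations x n)"
  by (simp add: continuations_def finite_ternary_strings)

lemma continuations_Suc:
  "continuations x (Suc n) = (\<Union>y \<in> {y \<in> {0, 1, 2}. admissible x y}. (#) y ` continuations y n)"
  (is "_ = ?R")
proof (rule set_eqI)
  fix s
  show "s \<in> continuations x (Suc n) \<longleftrightarrow> s \<in> ?R"
    by (cases s) (auto simp: continuations_def ternary_strings_def)
qed

text \<open>Different heads make the images disjoint, and prepending a fixed head is
  injective.\<close>

lemma card_UN_Cons_continuations:
  assumes "finite Y"
  shows "card (\<Union>y\<in>Y. (#) y ` continuations y n) = (\<Sum>y\<in>Y. card (continuations y n))"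
proof -
  have "card (\<Union>y\<in>Y. (#) y ` continuations y n) = (\<Sum>y\<in>Y. card ((#) y ` continuations y n))"
    using assms by (intro card_UN_disjoint) (auto simp: finite_continuations)
  then show ?thesis
    by (simp add: card_image)
qed

lemma card_continuations_Suc:
  "card (continuations 0 (Suc n)) = card (continuations 0 n) + card (continuations 2 n)"
  "card (continuations 1 (Suc n)) = card (continuations 0 n) + card (continuations 1 n)"
  "card (continuations 2 (Suc n)) =
     card (continuations 0 n) + card (continuations 1 n) + card (continuations 2 n)"
proof -
  have "{y \<in> {0, 1, 2}. admissible 0 y} = {0, 2}" "{y \<in> {0, 1, 2}. admissible 1 y} = {0, 1}"
    "{y \<in> {0, 1, 2}. admissible 2 y} = {0, 1, 2}"
    by (auto simp: admissible_def)
  then show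
    "card (continuations 0 (Suc n)) = card (continuations 0 n) + card (continuations 2 n)"
    "card (continuations 1 (Suc n)) = card (continuations 0 n) + card (continuations 1 n)"
    "card (continuations 2 (Suc n)) =
       card (continuations 0 n) + card (continuations 1 n) + card (continuations 2 n)"
    by (simp_all only: continuations_Suc card_UN_Cons_continuations finite.intros) simp_all
qed

text \<open>The three identities are proved together because the recurrences mix the three
  quantities. The index on the left is \<open>Suc n\<close> since the preceding letter adds one to
  the length of a continuation. The partial sum includes \<open>j = 0\<close>, the empty
  composition, so all three start correctly at \<open>n = 0\<close> with values 1, 1 and 2.\<close>

lemma card_alternating_compositions_continuations:
  "card (alternating_compositions False (Suc n)) =
     card (continuations 0 n) + card (continuations 1 n) \<and>
   card (alternating_compositions True (Suc n)) =
     card (continuations 0 n) + card (continuations 2 n) \<and>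
   (\<Sum>j\<le>Suc n. card (alternating_compositions False j)) =
     card (continuations 0 n) + card (continuations 1 n) + card (continuations 2 n)"
proof (induction n)
  case 0
  show ?case
    by (simp add: card_alternating_compositions_False card_alternating_compositions_True
        alternating_compositions_0 continuations_0)
next
  case (Suc n)
  \<comment> \<open>Splitting off the top summand \<open>j = Suc n\<close>, where the first part is
    1, leaves the sum that counts the compositions of \<open>Suc n\<close>.\<close>
  have "card (alternating_compositions False (Suc (Suc n))) =
      card (alternating_compositions False (Suc n)) + card (alternating_compositions True (Suc n))"
    by (simp add: card_alternating_compositions_False)
  moreover have "(\<Sum>j\<le>Suc (Suc n). card (alternating_compositions False j)) =
      (\<Sum>j\<le>Suc n. card (alternating_compositions False j)) +
      card (alternating_compositions False (Suc (Suc n)))"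
    by (rule sum.atMost_Suc)
  ultimately show ?case
    using Suc.IH card_alternating_compositions_True_Suc_Suc[of n] card_continuations_Suc[of n]
    by linarith
qed

lemma successively_iff_nth:
  "successively P xs \<longleftrightarrow> (\<forall>i. i + 1 < length xs \<longrightarrow> P (xs ! i) (xs ! (i + 1)))"
proof (induction P xs rule: successively.induct)
  case (3 P x y xs)
  have "(\<forall>i. i < Suc (length xs) \<longrightarrow> P ((x # y # xs) ! i) ((y # xs) ! i)) \<longleftrightarrow>
      P x y \<and> (\<forall>i. i < length xs \<longrightarrow> P ((y # xs) ! i) (xs ! i))"
    by (subst All_less_Suc2) simp
  then show ?case
    using 3 by simp
qed simp_all

lemma successively_admissible_iff_nth:
  "successively admissible s \<longleftrightarrow>
     (\<forall>i. i + 1 < length s \<longrightarrow> \<not> (s ! i = 0 \<and> s ! (i + 1) = 1)) \<and>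
     (\<forall>i. i + 1 < length s \<longrightarrow> \<not> (s ! i = 1 \<and> s ! (i + 1) = 2))"
  unfolding successively_iff_nth admissible_def by auto

theorem theorem3p3:
  fixes k :: nat
  assumes "k > 0"
  shows "card (even_colored_compositions k) =
    card {s \<in> ternary_strings k.
      (\<forall>i. i + 1 < k \<longrightarrow> \<not> (s ! i = 0 \<and> s ! (i + 1) = 1)) \<and>
      (\<forall>i. i + 1 < k \<longrightarrow> \<not> (s ! i = 1 \<and> s ! (i + 1) = 2)) \<and>
      s ! 0 \<noteq> 2 \<and> s ! (k - 1) \<noteq> 0}"
    (is "_ = card ?S")
proof -
  obtain n where k: "k = Suc n"
    using assms gr0_implies_Suc by blast
  \<comment> \<open>Excluding 2 as the first letter leaves the heads 0 and 1, so \<open>?S\<close>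
    is the union of two families of continuations.\<close>
  have "s \<in> ?S \<longleftrightarrow> s \<in> (\<Union>y\<in>{0, 1}. (#) y ` continuations y n)" for s
  proof -
    have "s \<in> ?S \<longleftrightarrow> s \<in> ternary_strings k \<and> successively admissible s \<and> hd s \<noteq> 2 \<and> last s \<noteq> 0"
    proof (cases "s \<in> ternary_strings k")
      case True
      then have len: "k = length s"
        by (simp add: ternary_strings_def)
      \<comment> \<open>Positivity of \<open>k\<close> enters here: on a nonempty string,
        \<open>s ! 0\<close> and \<open>s ! (k - 1)\<close> are \<open>hd s\<close> and
        \<open>last s\<close>.\<close>
      then have "s \<noteq> []"
        using assms by auto
      then show ?thesis
        unfolding successively_admissible_iff_nth len by (simp add: hd_conv_nth last_conv_nth)
    qed simp
    also have "\<dots> \<longleftrightarrow> s \<in> (\<Union>y\<in>{0, 1}. (#) y ` continuations y n)"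
      by (cases s) (auto simp: k continuations_def ternary_strings_def)
    finally show ?thesis .
  qed
  then have "?S = (\<Union>y\<in>{0, 1}. (#) y ` continuations y n)"
    by (rule set_eqI)
  then have "card ?S = (\<Sum>y\<in>{0, 1}. card (continuations y n))"
    by (simp only: card_UN_Cons_continuations finite.intros)
  then show ?thesis
    using card_alternating_compositions_continuations[of n]
    by (simp add: even_colored_compositions_eq k)
qed

end
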